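(* Let $K_1>0$, $K_1+K_2>1>K_2>0$, $a_2>a_1>0$, $c>0$, $m,n\in\mathbb{N}_0$, $A=a_2/a_1$, and define (the denominator being nonzero) $$T=\frac{a_1(1+K_1+K_2)+(a_2-a_1)(1-K_1)}{1-m(K_1-1)+n(1+K_1+K_2)},\qquad T_2=\frac{a_1H_{nm}(K_1)}{1-m(K_1-1)+n(1+K_1+K_2)},\qquad T_1=T-T_2,$$ where $$H_{nm}(K_1)=\bigl[m-n(A-1)\bigr](K_1+K_2+1)(K_1+2K_2-1)-K_1\bigl[(A-1)(1+K_2)-K_2\bigr]+K_2(1+K_2)+(A-1)(1-K_2).$$ Let the parameters be chosen so that $T_2>0$ and $\theta\in(0,1)$, where $$\theta=\frac{a_2-a_1-mT}{T_2},$$ and suppose that $\theta$ satisfies $\theta<\frac{T_1}{T_2}+1-\frac{1}{K_2}$ and, if $K_1\ge 1$, $$\theta<\Bigl(1-\frac{K_1}{2K_1+K_2-1}\Bigr)\frac{T_1}{T_2},$$ or, if $K_1<1$, $$\theta<\min\left\{1-\frac{(1-K_1)}{K_1}\frac{T_1}{T_2},\ \Bigl(1-\frac{1}{K_1+K_2}\Bigr)\frac{T_1}{T_2}\right\}.$$ Then the delay differential equation $$\epsilon\dot u(t)=-u(t)-K_1u(t-a_1-cu(t))-K_2u(t-a_2-cu(t))$$ has a periodic singular solution of period $T>0$ (a type II bimodal solution) whose profile $\Gamma(\mu)=(t(\mu),u(\mu))$, $\mu\in\mathbb{R}$, is given for each $i\in\mathbb{Z}$ by: for $\mu\in[4i,4i+1]$: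 $t(\mu)=(\mu-4i)T_1+iT$, $u(\mu)=\frac1c\bigl(-a_1+nT+(\mu-4i)T_1\bigr)$; for $\mu\in[4i+1,4i+2]$: $t(\mu)=T_1+iT$, $u(\mu)=\frac1c\bigl(-a_1+nT+T_1-(\mu-4i-1)\theta T_2\bigr)$; for $\mu\in[4i+2,4i+3]$: $t(\mu)=(\mu-4i-2)T_2+T_1+iT$, $u(\mu)=\frac1c\bigl(-a_1+nT+T_1-\theta T_2+(\mu-4i-2)T_2\bigr)$; for $\mu\in[4i+3,4i+4]$: $t(\mu)=(i+1)T$, $u(\mu)=\frac1c\bigl(-a_1+nT+(T-\theta T_2)(4i+4-\mu)\bigr)$.
   Context: $\mathbb{N}_0=\{0,1,2,\dots\}$. Admissible singular solution profile: a continuous injective parametric curve $\Gamma:I\to\mathbb{R}^2$, $\Gamma(\mu)=(t(\mu),u(\mu))$, on a nonempty interval $I\subseteq\mathbb{R}$, with $t$ monotonically increasing (not necessarily strictly). The interval $I$ is partitioned as $I=I^+\cup I^-\cup I^*$, where $I^*$ is a disjoint union of open intervals on each of which $t$ is strictly increasing, and $I^{\pm}$ are disjoint unions of closed intervals on each of which $t$ is constant, with $u$ strictly decreasing on each interval of $I^-$ and strictly increasing on each interval of $I^+$. Singular solution of the equation $\epsilon\dot u(t)=-u(t)-K_1u(t-a_1-cu(t))-K_2u(t-a_2-cu(t))$ (this is an $\epsilon=0$ notion): let $\Gamma$ be an admissible singular solution profile on $I$, let $J\subseteq\mathbb{R}$ be a nonempty interval, and let $\mu_0,\mu_1,\mu_2:J\to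 I$ be continuous with $\mu_0$ monotonically increasing. Set $J^*=\mathrm{cl}\{\eta:\mu_0(\eta)\in I^*\}$, $J^\pm=\mathrm{int}\{\eta:\mu_0(\eta)\in I^\pm\}$ and $$F(\eta)=-u(\mu_0(\eta))-K_1u(\mu_1(\eta))-K_2u(\mu_2(\eta)).$$ Then $\{\Gamma,\mu_0,\mu_1,\mu_2\}$ is a singular solution on $t(\mu_0(J))$ if $t(\mu_i(\eta))=t(\mu_0(\eta))-a_i-cu(\mu_0(\eta))$ for all $\eta\in J$ and $i=1,2$, and $F(\eta)=0$ for all $\eta\in J^*$, $F(\eta)<0$ for all $\eta\in J^-$, $F(\eta)>0$ for all $\eta\in J^+$. The singular solution is periodic if $J=\mathbb{R}$ and there exist $T>0$ and $\eta_T>0$ with $t(\mu_i(\eta+\eta_T))=t(\mu_i(\eta))+T$ and $u(\mu_i(\eta+\eta_T))=u(\mu_i(\eta))$ for all $i=0,1,2$ and all $\eta\in\mathbb{R}$; the period is the smallest such $T>0$. *)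

theory Defs
  imports "HOL-Analysis.Analysis"
begin

definition disjoint_union_of_intervals :: "(real set \<Rightarrow> bool) \<Rightarrow> real set \<Rightarrow> bool" where
  "disjoint_union_of_intervals P S \<longleftrightarrow>
     (\<exists>\<C>. disjoint \<C> \<and> \<Union>\<C> = S \<and> (\<forall>A\<in>\<C>. A \<noteq> {} \<and> is_interval A \<and> P A))"

definition nondegenerate :: "real set \<Rightarrow> bool" where
  "nondegenerate A \<longleftrightarrow> (\<exists>x\<in>A. \<exists>y\<in>A. x < y)"

text \<open>A curve is a function \<open>\<Gamma> = (t, u)\<close>; the sets \<open>Iplus\<close>, \<open>Iminus\<close>, \<open>Istar\<close> are
  \<open>I\<^sup>+\<close>, \<open>I\<^sup>-\<close>, \<open>I\<^sup>*\<close>. Open and closed intervals are understood relative to the parameter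
  interval \<open>I\<close>. Closed intervals have to be nondegenerate: every set is a disjoint union of
  singletons, on which the constancy and monotonicity requirements would be void. With this
  convention the partition of \<open>I\<close> is uniquely determined by \<open>\<Gamma>\<close>.\<close>

definition admissible_profile ::
  "real set \<Rightarrow> (real \<Rightarrow> real \<times> real) \<Rightarrow> real set \<Rightarrow> real set \<Rightarrow> real set \<Rightarrow> bool" where
  "admissible_profile I \<Gamma> Iplus Iminus Istar \<longleftrightarrow>
     (let t = (\<lambda>\<mu>. fst (\<Gamma> \<mu>)); u = (\<lambda>\<mu>. snd (\<Gamma> \<mu>)) in
       is_interval I \<and> I \<noteq> {} \<and>
       continuous_on I \<Gamma> \<and> inj_on \<Gamma> I \<and> mono_on I t \<and>
       I = Iplus \<union> Iminus \<union> Istar \<and> Iplus \<inter> Iminus = {} \<and> Iplus \<inter> Istar = {} \<and> Iminus \<inter> Istar = {} \<and>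
       disjoint_union_of_intervals
         (\<lambda>A. openin (top_of_set I) A \<and> strict_mono_on A t) Istar \<and>
       disjoint_union_of_intervals
         (\<lambda>A. closedin (top_of_set I) A \<and> nondegenerate A \<and>
              t constant_on A \<and> strict_antimono_on A u) Iminus \<and>
       disjoint_union_of_intervals
         (\<lambda>A. closedin (top_of_set I) A \<and> nondegenerate A \<and>
              t constant_on A \<and> strict_mono_on A u) Iplus)"

text \<open>The closure defining \<open>J\<^sup>*\<close> is restricted to \<open>J\<close>, since the functions \<open>\<mu>0\<close>, \<open>\<mu>1\<close>, \<open>\<mu>2\<close>
  live on \<open>J\<close> only; the interiors defining \<open>J\<^sup>-\<close> and \<open>J\<^sup>+\<close> are taken in the real line. The
  parameter \<open>\<epsilon>\<close> of the delay equation is \<open>0\<close> here.\<close>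

definition singular_solution ::
  "real \<Rightarrow> real \<Rightarrow> real \<Rightarrow> real \<Rightarrow> real \<Rightarrow> real set \<Rightarrow> (real \<Rightarrow> real \<times> real) \<Rightarrow> real set \<Rightarrow>
    (real \<Rightarrow> real) \<Rightarrow> (real \<Rightarrow> real) \<Rightarrow> (real \<Rightarrow> real) \<Rightarrow> bool" where
  "singular_solution K1 K2 a1 a2 c I \<Gamma> J \<mu>0 \<mu>1 \<mu>2 \<longleftrightarrow>
     (let t = (\<lambda>\<mu>. fst (\<Gamma> \<mu>)); u = (\<lambda>\<mu>. snd (\<Gamma> \<mu>));
          F = (\<lambda>\<eta>. - u (\<mu>0 \<eta>) - K1 * u (\<mu>1 \<eta>) - K2 * u (\<mu>2 \<eta>)) in
       \<exists>Iplus Iminus Istar. admissible_profile I \<Gamma> Iplus Iminus Istar \<and>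
         is_interval J \<and> J \<noteq> {} \<and>
         (\<forall>\<mu>\<in>{\<mu>0, \<mu>1, \<mu>2}. continuous_on J \<mu> \<and> \<mu> ` J \<subseteq> I) \<and>
         mono_on J \<mu>0 \<and>
         (\<forall>\<eta>\<in>J. t (\<mu>1 \<eta>) = t (\<mu>0 \<eta>) - a1 - c * u (\<mu>0 \<eta>)) \<and>
         (\<forall>\<eta>\<in>J. t (\<mu>2 \<eta>) = t (\<mu>0 \<eta>) - a2 - c * u (\<mu>0 \<eta>)) \<and>
         (\<forall>\<eta> \<in> J \<inter> closure {\<eta>\<in>J. \<mu>0 \<eta> \<in> Istar}. F \<eta> = 0) \<and>
         (\<forall>\<eta> \<in> interior {\<eta>\<in>J. \<mu>0 \<eta> \<in> Iminus}. F \<eta> < 0) \<and>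
         (\<forall>\<eta> \<in> interior {\<eta>\<in>J. \<mu>0 \<eta> \<in> Iplus}. F \<eta> > 0))"

definition shift_period ::
  "(real \<Rightarrow> real \<times> real) \<Rightarrow> (real \<Rightarrow> real) \<Rightarrow> (real \<Rightarrow> real) \<Rightarrow> (real \<Rightarrow> real) \<Rightarrow> real \<Rightarrow> bool" where
  "shift_period \<Gamma> \<mu>0 \<mu>1 \<mu>2 T \<longleftrightarrow>
     T > 0 \<and>
     (\<exists>\<eta>T>0. \<forall>\<mu>\<in>{\<mu>0, \<mu>1, \<mu>2}. \<forall>\<eta>.
        fst (\<Gamma> (\<mu> (\<eta> + \<eta>T))) = fst (\<Gamma> (\<mu> \<eta>)) + T \<and>
        snd (\<Gamma> (\<mu> (\<eta> + \<eta>T))) = snd (\<Gamma> (\<mu> \<eta>)))"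

definition periodic_singular_solution ::
  "real \<Rightarrow> real \<Rightarrow> real \<Rightarrow> real \<Rightarrow> real \<Rightarrow> real set \<Rightarrow> (real \<Rightarrow> real \<times> real) \<Rightarrow>
    (real \<Rightarrow> real) \<Rightarrow> (real \<Rightarrow> real) \<Rightarrow> (real \<Rightarrow> real) \<Rightarrow> real \<Rightarrow> bool" where
  "periodic_singular_solution K1 K2 a1 a2 c I \<Gamma> \<mu>0 \<mu>1 \<mu>2 T \<longleftrightarrow>
     singular_solution K1 K2 a1 a2 c I \<Gamma> UNIV \<mu>0 \<mu>1 \<mu>2 \<and>
     shift_period \<Gamma> \<mu>0 \<mu>1 \<mu>2 T \<and>
     (\<forall>T'. shift_period \<Gamma> \<mu>0 \<mu>1 \<mu>2 T' \<longrightarrow> T \<le> T')"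

definition H_nm :: "nat \<Rightarrow> nat \<Rightarrow> real \<Rightarrow> real \<Rightarrow> real \<Rightarrow> real" where
  "H_nm n m A K2 K1 =
     (real m - real n * (A - 1)) * (K1 + K2 + 1) * (K1 + 2 * K2 - 1)
     - K1 * ((A - 1) * (1 + K2) - K2) + K2 * (1 + K2) + (A - 1) * (1 - K2)"

definition type_II_bimodal_profile ::
  "real \<Rightarrow> real \<Rightarrow> nat \<Rightarrow> real \<Rightarrow> real \<Rightarrow> real \<Rightarrow> real \<Rightarrow> (real \<Rightarrow> real \<times> real) \<Rightarrow> bool" where
  "type_II_bimodal_profile a1 c n T T1 T2 \<theta> \<Gamma> \<longleftrightarrow>
     (\<forall>k::int. let i = real_of_int k in
       (\<forall>\<mu>\<in>{4*i .. 4*i+1}. \<Gamma> \<mu> =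
          ((\<mu> - 4*i) * T1 + i * T,
           1/c * (- a1 + real n * T + (\<mu> - 4*i) * T1))) \<and>
       (\<forall>\<mu>\<in>{4*i+1 .. 4*i+2}. \<Gamma> \<mu> =
          (T1 + i * T,
           1/c * (- a1 + real n * T + T1 - (\<mu> - 4*i - 1) * \<theta> * T2))) \<and>
       (\<forall>\<mu>\<in>{4*i+2 .. 4*i+3}. \<Gamma> \<mu> =
          ((\<mu> - 4*i - 2) * T2 + T1 + i * T,
           1/c * (- a1 + real n * T + T1 - \<theta> * T2 + (\<mu> - 4*i - 2) * T2))) \<and>
       (\<forall>\<mu>\<in>{4*i+3 .. 4*i+4}. \<Gamma> \<mu> =
          ((i + 1) * T,
           1/c * (- a1 + real n * T + (T - \<theta> * T2) * (4*i + 4 - \<mu>)))))"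

end

theory Submission imports Defs begin

text \<open>
  Write \<open>v = c u\<close>, \<open>b = - a1 + n T\<close> and \<open>d = \<theta> T2 = a2 - a1 - m T\<close>. Over one period the curve
  \<open>(t, v)\<close> has four straight legs: \<open>v\<close> rises with slope one from \<open>b\<close> over a time \<open>T1\<close>, jumps
  down by \<open>d\<close>, rises with slope one over a time \<open>T2\<close>, and jumps down to \<open>b\<close>. On a rising leg
  both delayed times \<open>t - a1 - v\<close> and \<open>t - a2 - v\<close> are constant. On the first leg the time
  \<open>t - a1 - v\<close> sits on a vertical leg, so \<open>\<mu>1\<close> may slide down that leg and keep \<open>F = 0\<close> while \<open>v\<close>
  rises; on the third leg \<open>\<mu>2\<close> does the same. At the end of a rising leg the sliding delay has
  to be at the bottom corner of its vertical leg, as the delayed time then starts to increase;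
  \<open>F = 0\<close> at these two corners is a pair of linear equations for \<open>T\<close> and \<open>T2\<close>, and the
  formulas for \<open>T\<close> and \<open>T2\<close> (with \<open>H_nm\<close>) are its solution.

  During a falling leg \<open>v\<close> decreases at unit rate while both delayed values grow at unit rate, so
  \<open>- c F\<close> grows with slope \<open>K1 + K2 - 1 > 0\<close>, except when a delayed argument runs through the
  jump of size \<open>d\<close>: this costs \<open>K1 d\<close> and then \<open>K2 d\<close>, and the bounds on \<open>\<theta>\<close> in terms of
  \<open>T1 / T2\<close> say that \<open>- c F\<close> stays positive. The remaining bounds on \<open>\<theta>\<close> say that the vertical
  leg of height \<open>T - d\<close> is long enough for the slides, which cover heights \<open>T1 / K1\<close> and
  \<open>T2 / K2\<close>.

  One period of the solution thus has ten phases, in each of which every \<open>\<mu>i\<close> runs affinely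
  inside a single leg of the curve. The curve and the \<open>\<mu>i\<close> are therefore encoded as piecewise linear
  interpolations at the integers. By \<open>interpolate_compose\<close>, the functions \<open>t \<circ> \<mu>i\<close>, \<open>v \<circ> \<mu>i\<close> and
  \<open>F\<close> are then again such interpolations, and every condition is checked on the ten nodes
  (\<open>delay_nodes\<close>, \<open>excess_zero\<close>, \<open>excess_pos\<close>).

  \<open>T\<close> is the least period since \<open>v\<close> takes its minimum \<open>b\<close> only at the times \<open>i T\<close>
  (\<open>minimum_of_u\<close>).
\<close>

section \<open>Piecewise linear interpolation at the integers\<close>

definition interpolate :: "(int \<Rightarrow> real) \<Rightarrow> real \<Rightarrow> real" where
  "interpolate y x = y \<lfloor>x\<rfloor> + frac x * (y (\<lfloor>x\<rfloor> + 1) - y \<lfloor>x\<rfloor>)"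

lemma interpolate_on:
  assumes "of_int k \<le> x" "x \<le> of_int k + 1"
  shows "interpolate y x = y k + (x - of_int k) * (y (k + 1) - y k)"
proof (cases "x = of_int k + 1")
  case True
  then have "\<lfloor>x\<rfloor> = k + 1" "frac x = 0" by (auto simp: frac_def)
  then show ?thesis using True by (simp add: interpolate_def)
next
  case False
  then have "\<lfloor>x\<rfloor> = k" using assms by (simp add: floor_eq_iff)
  then show ?thesis by (simp add: interpolate_def frac_def)
qed

lemma interpolate_of_int [simp]: "interpolate y (of_int k) = y k"
  by (simp add: interpolate_def)

lemma interpolate_shift:
  assumes "\<And>k. y (k + N) = y k + C"
  shows "interpolate y (x + of_int N) = interpolate y x + C"
proof -
  have "\<lfloor>x + of_int N\<rfloor> = \<lfloor>x\<rfloor> + N" "frac (x + of_int N) = frac x" by (simp_all add: frac_def)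
  moreover have "y (\<lfloor>x\<rfloor> + N + 1) = y (\<lfloor>x\<rfloor> + 1) + C"
    using assms[of "\<lfloor>x\<rfloor> + 1"] by (simp add: ac_simps)
  ultimately show ?thesis using assms[of "\<lfloor>x\<rfloor>"] unfolding interpolate_def by simp
qed

lemma continuous_on_interpolate: "continuous_on UNIV (interpolate y)"
proof -
  have piece: "continuous_on {of_int k..of_int k + 1} (interpolate y)" for k
  proof (rule continuous_on_eq)
    show "continuous_on {of_int k..of_int k + 1} (\<lambda>x. y k + (x - of_int k) * (y (k + 1) - y k))"
      by (intro continuous_intros)
  qed (simp add: interpolate_on[of k])
  have "isCont (interpolate y) x" for x
  proof -
    define k where "k = \<lfloor>x\<rfloor>"
    have split: "{of_int k - 1..of_int k + 1} = {of_int (k - 1)..of_int (k - 1) + 1} \<union> {of_int k..of_int k + 1 :: real}"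
      by auto
    have "continuous_on {of_int k - 1..of_int k + 1} (interpolate y)"
      unfolding split by (intro continuous_on_closed_Un piece) auto
    moreover have "x \<in> interior {of_int k - 1..of_int k + 1}"
      unfolding k_def interior_atLeastAtMost_real by simp linarith
    ultimately show ?thesis by (rule continuous_on_interior)
  qed
  then show ?thesis by (simp add: continuous_at_imp_continuous_on)
qed

lemma interpolate_linear:
  "interpolate (\<lambda>k. f k - a - g k) x = interpolate f x - a - interpolate g x"
  "interpolate (\<lambda>k. f k + p * g k + q * h k) x =
     interpolate f x + p * interpolate g x + q * interpolate h x"
  by (simp_all add: interpolate_def algebra_simps)

lemma interpolate_between:
  assumes "of_int k \<le> x" "x \<le> of_int k + 1" "lo \<le> y k" "lo \<le> y (k + 1)" "y k \<le> hi" "y (k + 1) \<le> hi"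
  shows "lo \<le> interpolate y x" "interpolate y x \<le> hi"
proof -
  define s where "s = x - of_int k"
  have s: "0 \<le> s" "s \<le> 1" using assms by (auto simp: s_def)
  have eq: "interpolate y x = (1 - s) * y k + s * y (k + 1)"
    using interpolate_on[OF assms(1,2)] by (simp add: s_def algebra_simps)
  show "lo \<le> interpolate y x" unfolding eq
    using convex_bound_le[of "- y k" "-lo" "- y (k + 1)" "1 - s" s] s assms by simp
  show "interpolate y x \<le> hi" unfolding eq
    using convex_bound_le[of "y k" "hi" "y (k + 1)" "1 - s" s] s assms by simp
qed

lemma mono_int_steps:
  fixes y :: "int \<Rightarrow> real"
  assumes "\<And>k. y k \<le> y (k + 1)" "i \<le> j"
  shows "y i \<le> y j"
  using assms(2) by (induction j rule: int_ge_induct) (use assms(1) order_trans in blast)+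

lemma mono_interpolate:
  assumes "\<And>k. y k \<le> y (k + 1)"
  shows "mono (interpolate y)"
proof (rule monoI)
  fix x x' :: real assume le: "x \<le> x'"
  show "interpolate y x \<le> interpolate y x'"
  proof (cases "\<lfloor>x\<rfloor> = \<lfloor>x'\<rfloor>")
    case True
    then show ?thesis using le assms[of "\<lfloor>x\<rfloor>"]
      unfolding interpolate_def frac_def by (simp add: mult_right_mono)
  next
    case False
    with floor_mono[OF le] have "\<lfloor>x\<rfloor> + 1 \<le> \<lfloor>x'\<rfloor>" by linarith
    then have "y (\<lfloor>x\<rfloor> + 1) \<le> y \<lfloor>x'\<rfloor>" by (rule mono_int_steps[rotated]) (rule assms)
    moreover have "interpolate y x \<le> y (\<lfloor>x\<rfloor> + 1)"
      by (rule interpolate_between(2)[of "\<lfloor>x\<rfloor>" _ "y \<lfloor>x\<rfloor>"]) (use assms in auto)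
    moreover have "y \<lfloor>x'\<rfloor> \<le> interpolate y x'"
      by (rule interpolate_between(1)[of "\<lfloor>x'\<rfloor>" _ _ _ "y (\<lfloor>x'\<rfloor> + 1)"]) (use assms in auto)
    ultimately show ?thesis by linarith
  qed
qed

lemma strict_mono_interpolate:
  assumes less: "\<And>k. y k < y (k + 1)"
  shows "strict_mono (interpolate y)"
proof (rule strict_monoI)
  fix x x' :: real assume lt: "x < x'"
  have le: "\<forall>k. y k \<le> y (k + 1)" using less less_imp_le by blast
  show "interpolate y x < interpolate y x'"
  proof (cases "\<lfloor>x\<rfloor> = \<lfloor>x'\<rfloor>")
    case True
    then show ?thesis using lt less[of "\<lfloor>x\<rfloor>"]
      unfolding interpolate_def frac_def by simp
  next
    case False
    then have "\<lfloor>x\<rfloor> + 1 \<le> \<lfloor>x'\<rfloor>" using floor_mono[of x x'] lt by simp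
    then have "of_int (\<lfloor>x\<rfloor> + 1) \<le> x'" by (simp add: le_floor_iff)
    then have "y (\<lfloor>x\<rfloor> + 1) \<le> interpolate y x'"
      using monoD[OF mono_interpolate[of y, OF le[rule_format]]] by (metis interpolate_of_int)
    moreover have "interpolate y x < y (\<lfloor>x\<rfloor> + 1)"
    proof -
      have "0 < (1 - frac x) * (y (\<lfloor>x\<rfloor> + 1) - y \<lfloor>x\<rfloor>)"
        using less frac_lt_1[of x] by simp
      then show ?thesis by (simp add: interpolate_def algebra_simps)
    qed
    ultimately show ?thesis by linarith
  qed
qed

text \<open>A leg is the part of the parameter line between two consecutive integers.\<close>

definition same_leg :: "real \<Rightarrow> real \<Rightarrow> bool" where
  "same_leg x y \<longleftrightarrow> (\<exists>l::int. x \<in> {of_int l..of_int l + 1} \<and> y \<in> {of_int l..of_int l + 1})"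

lemma same_leg_shift: "same_leg x y \<Longrightarrow> same_leg (x + of_int i) (y + of_int i)"
  unfolding same_leg_def by (elim exE, rule_tac x = "l + i" in exI) auto

text \<open>On a leg the outer function is affine. If the inner function keeps each of its own legs
  inside one leg of the outer function, then the composition has no kinks besides the
  integers and is determined by its values there.\<close>

lemma interpolate_compose:
  assumes "\<And>k. same_leg (p k) (p (k + 1))"
  shows "interpolate y (interpolate p x) = interpolate (\<lambda>k. interpolate y (p k)) x"
proof -
  define k s where "k = \<lfloor>x\<rfloor>" and "s = frac x"
  obtain l :: int where l: "of_int l \<le> p k" "p k \<le> of_int l + 1"
    "of_int l \<le> p (k + 1)" "p (k + 1) \<le> of_int l + 1"
    using assms[of k] by (auto simp: same_leg_def)
  have "of_int l \<le> interpolate p x" "interpolate p x \<le> of_int l + 1"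
    using interpolate_between[of k x "of_int l" p "of_int l + 1"] l by (auto simp: k_def)
  then show ?thesis
    using l unfolding interpolate_def[of "\<lambda>k. interpolate y (p k)"]
    by (simp flip: k_def s_def add: interpolate_on[of l])
      (simp add: interpolate_def[of p] algebra_simps flip: k_def s_def)
qed

section \<open>Periodic node sequences\<close>

definition periodic_nodes :: "real list \<Rightarrow> real \<Rightarrow> int \<Rightarrow> real" where
  "periodic_nodes xs C k =
     xs ! nat (k mod int (length xs)) + C * of_int (k div int (length xs))"

lemma periodic_nodes_shift:
  assumes "xs \<noteq> []"
  shows "periodic_nodes xs C (k + int (length xs) * i) = periodic_nodes xs C k + C * of_int i"
  using assms by (simp add: periodic_nodes_def algebra_simps)

lemma interpolate_periodic_nodes_shift:
  assumes "xs \<noteq> []"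
  shows "interpolate (periodic_nodes xs C) (x + of_int (int (length xs) * i))
       = interpolate (periodic_nodes xs C) x + C * of_int i"
  by (rule interpolate_shift) (rule periodic_nodes_shift[OF assms])

text \<open>The successor node is read off the shifted list, whose last entry is the first node of
  the next period. This allows statements about consecutive nodes to be checked by
  evaluating two lists.\<close>

lemma periodic_nodes_Suc:
  assumes "xs \<noteq> []"
  shows "periodic_nodes xs C (k + 1) =
    (tl xs @ [hd xs + C]) ! nat (k mod int (length xs)) + C * of_int (k div int (length xs))"
proof -
  define j i where "j = k mod int (length xs)" and "i = k div int (length xs)"
  have k: "k + 1 = (j + 1) + int (length xs) * i" by (simp add: j_def i_def)
  have j: "0 \<le> j" "j < int (length xs)" using assms by (auto simp: j_def)
  have "periodic_nodes xs C (j + 1) = (tl xs @ [hd xs + C]) ! nat j"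
  proof (cases "j + 1 < int (length xs)")
    case True
    with j have "Suc (nat j) < length xs" "nat (j + 1) = Suc (nat j)" by auto
    with j True show ?thesis by (auto simp: periodic_nodes_def nth_append nth_tl)
  next
    case False
    with j have jl: "j + 1 = int (length xs)" by simp
    then have "nat j = length (tl xs)" by simp
    then have "(tl xs @ [hd xs + C]) ! nat j = hd xs + C" by (simp only: nth_append_length)
    then show ?thesis unfolding jl using assms by (simp add: periodic_nodes_def hd_conv_nth)
  qed
  then show ?thesis unfolding k periodic_nodes_shift[OF assms] by (simp add: j_def i_def)
qed

text \<open>The list \<open>ls\<close> names, for each entry of \<open>xs\<close>, a leg that contains this entry and the next;
  later periods use the same legs, shifted by \<open>P\<close>.\<close>

lemma periodic_nodes_leg:
  fixes P :: int
  assumes ne: "xs \<noteq> []"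
    and legs: "list_all2 (\<lambda>l (x, y). {x, y} \<subseteq> {of_int l..of_int l + 1}) ls
      (zip xs (tl xs @ [hd xs + of_int P]))"
    and l: "l = ls ! nat (k mod int (length xs)) + P * (k div int (length xs))"
  shows "periodic_nodes xs (of_int P) k \<in> {of_int l..of_int l + 1}"
    and "periodic_nodes xs (of_int P) (k + 1) \<in> {of_int l..of_int l + 1}"
proof -
  have "nat (k mod int (length xs)) < length xs" using ne by (auto simp: nat_less_iff)
  with list_all2_nthD2[OF legs, of "nat (k mod int (length xs))"]
  show "periodic_nodes xs (of_int P) k \<in> {of_int l..of_int l + 1}"
    and "periodic_nodes xs (of_int P) (k + 1) \<in> {of_int l..of_int l + 1}"
    unfolding periodic_nodes_Suc[OF ne] using ne by (auto simp: l periodic_nodes_def)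
qed

lemma interpolate_at_periodic_nodes:
  assumes "xs \<noteq> []" "ys \<noteq> []"
  shows "interpolate (periodic_nodes ys C) (periodic_nodes xs (real (length ys)) k + of_int (int (length ys) * l))
       = periodic_nodes (map (interpolate (periodic_nodes ys C)) xs) C k + C * of_int l"
proof -
  define j i where "j = k mod int (length xs)" and "i = k div int (length xs)"
  have "nat j < length xs" using assms(1) by (auto simp: j_def nat_less_iff)
  moreover have "periodic_nodes xs (real (length ys)) k + of_int (int (length ys) * l)
      = xs ! nat j + of_int (int (length ys) * (i + l))"
    by (simp add: periodic_nodes_def j_def i_def algebra_simps)
  ultimately show ?thesis
    using interpolate_periodic_nodes_shift[OF assms(2), of C "xs ! nat j" "i + l"]
    by (simp add: periodic_nodes_def algebra_simps flip: j_def i_def)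
qed

text \<open>The phase \<open>j\<close> and the period \<open>q\<close> of a node, detached from the arithmetic of \<open>div\<close> and
  \<open>mod\<close>, for sequences with ten nodes per period.\<close>

lemma ten_phases:
  fixes k :: int
  obtains j :: nat and q :: int where "k mod 10 = int j" "k div 10 = q"
    "j = 0 \<or> j = 1 \<or> j = 2 \<or> j = 3 \<or> j = 4 \<or> j = 5 \<or> j = 6 \<or> j = 7 \<or> j = 8 \<or> j = 9"
    "\<And>xs C. length xs = 10 \<Longrightarrow> periodic_nodes xs C k = xs ! j + C * of_int q"
    "\<And>xs C. length xs = 10 \<Longrightarrow>
      periodic_nodes xs C (k + 1) = (tl xs @ [hd xs + C]) ! j + C * of_int q"
proof
  define j where "j = nat (k mod 10)"
  show "k mod 10 = int j" "k div 10 = k div 10" by (simp_all add: j_def)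
  have "j < 10" by (simp add: j_def nat_less_iff)
  then show "j = 0 \<or> j = 1 \<or> j = 2 \<or> j = 3 \<or> j = 4 \<or> j = 5 \<or> j = 6 \<or> j = 7 \<or> j = 8 \<or> j = 9"
    by presburger
  fix xs :: "real list" and C :: real
  assume l: "length xs = 10"
  then have "xs \<noteq> []" by auto
  from periodic_nodes_Suc[OF this, of C k] l
  show "periodic_nodes xs C (k + 1) = (tl xs @ [hd xs + C]) ! j + C * of_int (k div 10)"
    by (simp add: j_def)
  show "periodic_nodes xs C k = xs ! j + C * of_int (k div 10)"
    using l by (simp add: periodic_nodes_def j_def)
qed

section \<open>The solution\<close>

text \<open>The hypotheses of the theorem in the form in which the construction uses them. The two
  balance equations state \<open>F = 0\<close> at the end of the first and third leg. In the first of
  them the value at \<open>\<mu>2\<close> is \<open>b + T - 2 d\<close>, a distance \<open>d\<close> below the top of the third leg. The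
  \<open>drop\<close> inequalities keep \<open>F\<close> negative after one and after both delayed arguments
  have passed the jump of size \<open>d\<close>, and the \<open>level\<close> inequalities make room for the slides
  along the vertical leg of height \<open>T - d\<close>. The period \<open>T\<close> is written as \<open>T1 + T2\<close>.\<close>

locale type_II_bimodal =
  fixes K1 K2 a1 a2 c b T1 T2 \<theta> d :: real and m n :: nat
  assumes K: "K1 > 0" "K2 > 0" "K1 + K2 > 1" and c: "c > 0"
    and T12: "T1 > 0" "T2 > 0"
    and \<theta>: "0 < \<theta>" "\<theta> < 1" and d: "\<theta> * T2 = d"
    and b: "- a1 + real n * (T1 + T2) = b"
    and a2: "a2 = a1 + real m * (T1 + T2) + d"
    and leg1_balance: "b * (1 + K1 + K2) + T1 + K2 * (T1 + T2 - 2 * d) = 0"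
    and leg3_balance: "b * (1 + K1 + K2) + T1 + T2 - d + K1 * d = 0"
    and drop1: "d * (2 * K1 + K2 - 1) < T1 * (K1 + K2 - 1)"
    and drop2: "d * (K1 + K2) < T1 * (K1 + K2 - 1)"
    and level1: "T1 < K1 * (T1 + T2 - d)"
    and level2: "T2 < K2 * (T1 + T2 - d)"
begin

abbreviation T where "T \<equiv> T1 + T2"

lemma d_bounds: "0 < d" "d < T2" "d < T1"
proof -
  show "0 < d" "d < T2" using T12 \<theta> by (auto simp flip: d)
  have "d * (K1 + K2) < T1 * (K1 + K2)" using drop2 T12 by (simp add: algebra_simps)
  then show "d < T1" using K by simp
qed

subsection \<open>The curve\<close>

text \<open>Values of \<open>t\<close> and of \<open>v = c u\<close> at the integer parameters, the corners of the curve.\<close>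

definition tn :: "int \<Rightarrow> real" where "tn = periodic_nodes [0, T1, T1, T] T"
definition vn :: "int \<Rightarrow> real" where "vn = periodic_nodes [b, b + T1, b + T1 - d, b + T - d] 0"

definition Gam :: "real \<Rightarrow> real \<times> real" where
  "Gam x = (interpolate tn x, interpolate vn x / c)"

lemma tn_shift: "tn (k + 4 * i) = tn k + T * of_int i"
  using periodic_nodes_shift[of "[0, T1, T1, T]" T k i] by (simp add: tn_def)

lemma vn_shift: "vn (k + 4 * i) = vn k"
  using periodic_nodes_shift[of "[b, b + T1, b + T1 - d, b + T - d]" 0 k i] by (simp add: vn_def)

lemma base_nodes [simp]:
  "tn (-2) = T1 - T" "tn (-1) = 0" "tn 0 = 0" "tn 1 = T1" "tn 2 = T1" "tn 3 = T" "tn 4 = T"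
  "vn (-2) = b + T1 - d" "vn (-1) = b + T - d" "vn 0 = b" "vn 1 = b + T1" "vn 2 = b + T1 - d"
  "vn 3 = b + T - d" "vn 4 = b"
  by (simp_all add: tn_def vn_def periodic_nodes_def)

lemma nodes [simp]:
  "tn (4 * i) = T * of_int i" "tn (4 * i + 1) = T1 + T * of_int i" "tn (4 * i + 2) = T1 + T * of_int i"
  "tn (4 * i + 3) = T + T * of_int i" "tn (4 * i + 4) = T + T * of_int i"
  "vn (4 * i) = b" "vn (4 * i + 1) = b + T1" "vn (4 * i + 2) = b + T1 - d"
  "vn (4 * i + 3) = b + T - d" "vn (4 * i + 4) = b"
  using tn_shift[of 0 i] tn_shift[of 1 i] tn_shift[of 2 i] tn_shift[of 3 i] tn_shift[of 4 i]
    vn_shift[of 0 i] vn_shift[of 1 i] vn_shift[of 2 i] vn_shift[of 3 i] vn_shift[of 4 i]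
  by (simp_all add: add.commute)

lemma int_mod_4_cases:
  fixes k :: int
  obtains i where "k = 4 * i" | i where "k = 4 * i + 1" | i where "k = 4 * i + 2" | i where "k = 4 * i + 3"
  by atomize_elim presburger

lemma even_leg: "even k \<Longrightarrow> tn k < tn (k + 1)"
  using T12 by (cases k rule: int_mod_4_cases) (auto simp: add.assoc)

lemma odd_leg: "odd k \<Longrightarrow> tn (k + 1) = tn k" "odd k \<Longrightarrow> vn (k + 1) < vn k"
  using T12 d_bounds by (cases k rule: int_mod_4_cases; auto simp: add.assoc)+

lemma tn_mono: "tn k \<le> tn (k + 1)"
  using even_leg[of k] odd_leg[of k] by force

lemma Gam_profile: "type_II_bimodal_profile a1 c n T T1 T2 \<theta> Gam"
  unfolding type_II_bimodal_profile_def Let_def b mult.assoc[of _ \<theta> T2] d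
proof (intro allI conjI ballI)
  fix i :: int and \<mu> :: real
  let ?i = "real_of_int i"
  note on = interpolate_on[of _ \<mu> tn] interpolate_on[of _ \<mu> vn]
  show "Gam \<mu> = ((\<mu> - 4 * ?i) * T1 + ?i * T, 1/c * (b + (\<mu> - 4 * ?i) * T1))"
    if "\<mu> \<in> {4 * ?i..4 * ?i + 1}"
    using that on[of "4 * i"] by (simp add: Gam_def)
  show "Gam \<mu> = (T1 + ?i * T, 1/c * (b + T1 - (\<mu> - 4 * ?i - 1) * d))"
    if "\<mu> \<in> {4 * ?i + 1..4 * ?i + 2}"
    using that on[of "4 * i + 1"] by (simp add: Gam_def add.assoc)
  show "Gam \<mu> = ((\<mu> - 4 * ?i - 2) * T2 + T1 + ?i * T, 1/c * (b + T1 - d + (\<mu> - 4 * ?i - 2) * T2))"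
    if "\<mu> \<in> {4 * ?i + 2..4 * ?i + 3}"
    using that on[of "4 * i + 2"] by ((simp add: Gam_def add.assoc); (simp add: algebra_simps)?)
  show "Gam \<mu> = ((?i + 1) * T, 1/c * (b + (T - d) * (4 * ?i + 4 - \<mu>)))"
    if "\<mu> \<in> {4 * ?i + 3..4 * ?i + 4}"
    using that on[of "4 * i + 3"] by ((simp add: Gam_def add.assoc); (simp add: algebra_simps)?)
qed

text \<open>Time alone does not separate points on the vertical legs, but \<open>2 t - v\<close> does: on the rising
  legs \<open>t\<close> and \<open>v\<close> increase by the same amount, on the vertical legs \<open>t\<close> is constant and \<open>v\<close>
  falls.\<close>

lemma inj_Gam: "inj Gam"
proof -
  have step: "2 * tn k - vn k < 2 * tn (k + 1) - vn (k + 1)" for k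
    using T12 d_bounds by (cases k rule: int_mod_4_cases) (auto simp: add.assoc)
  have "interpolate (\<lambda>k. 2 * tn k - vn k) x = 2 * fst (Gam x) - c * snd (Gam x)" for x
    using c by (simp add: Gam_def) (simp add: interpolate_def algebra_simps)
  then have "x = y" if "Gam x = Gam y" for x y
    using strict_mono_eq[OF strict_mono_interpolate[of "\<lambda>k. 2 * tn k - vn k", OF step], of x y] that by simp
  then show ?thesis by (simp add: injI)
qed

text \<open>\<open>slow\<close> and \<open>fast\<close> serve as \<open>I\<^sup>*\<close> and \<open>I\<^sup>-\<close>; the set \<open>I\<^sup>+\<close> is empty. The corners belong to
  the closed vertical legs.\<close>

definition slow :: "real set" where "slow = (\<Union>k\<in>{k. even k}. {of_int k<..<of_int k + 1})"
definition fast :: "real set" where "fast = (\<Union>k\<in>{k. odd k}. {of_int k..of_int k + 1})"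

lemma slow_fast: "slow \<inter> fast = {}" "slow \<union> fast = UNIV"
proof -
  have False if "even k" "odd l" "x \<in> {of_int k<..<of_int k + 1}" "x \<in> {of_int l..of_int l + 1}"
    for k l :: int and x :: real
  proof -
    have "of_int k < of_int l + (1::real)" "of_int l < of_int k + (1::real)" using that by auto
    then have "k = l" by linarith
    with that show False by simp
  qed
  then show "slow \<inter> fast = {}" unfolding slow_def fast_def by blast
  have "x \<in> slow \<union> fast" for x
  proof (cases "even \<lfloor>x\<rfloor> \<and> of_int \<lfloor>x\<rfloor> < x")
    case True
    then have "x \<in> {of_int \<lfloor>x\<rfloor><..<of_int \<lfloor>x\<rfloor> + 1}" by auto
    with True show ?thesis unfolding slow_def by blast
  next
    case False
    consider "odd \<lfloor>x\<rfloor>" | "even \<lfloor>x\<rfloor>" "x = of_int \<lfloor>x\<rfloor>" using False of_int_floor_le[of x] by fastforce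
    then show ?thesis
    proof cases
      case 1
      moreover have "x \<in> {of_int \<lfloor>x\<rfloor>..of_int \<lfloor>x\<rfloor> + 1}" by simp
      ultimately show ?thesis unfolding fast_def by blast
    next
      case 2
      then have "odd (\<lfloor>x\<rfloor> - 1)" by simp
      moreover have "x \<in> {of_int (\<lfloor>x\<rfloor> - 1)..of_int (\<lfloor>x\<rfloor> - 1) + 1}" using 2 by simp
      ultimately show ?thesis unfolding fast_def by blast
    qed
  qed
  then show "slow \<union> fast = UNIV" by auto
qed

lemma disjoint_imageI:
  assumes "\<And>k l. k \<in> S \<Longrightarrow> l \<in> S \<Longrightarrow> k \<noteq> l \<Longrightarrow> f k \<inter> f l = {}"
  shows "disjoint (f ` S)"
  unfolding disjoint_def using assms by (metis imageE)

lemma admissible_Gam: "admissible_profile UNIV Gam {} fast slow"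
  unfolding admissible_profile_def Let_def
proof (intro conjI)
  show "continuous_on UNIV Gam"
    unfolding Gam_def using c by (intro continuous_intros continuous_on_interpolate) simp
  show "inj Gam" by (rule inj_Gam)
  show "mono (\<lambda>\<mu>. fst (Gam \<mu>))"
    using mono_interpolate[of tn, OF tn_mono] by (simp add: Gam_def)
  show "UNIV = {} \<union> fast \<union> slow" "fast \<inter> slow = {}" using slow_fast by auto
  show "disjoint_union_of_intervals
     (\<lambda>A. openin (top_of_set UNIV) A \<and> strict_mono_on A (\<lambda>\<mu>. fst (Gam \<mu>))) slow"
    unfolding disjoint_union_of_intervals_def
  proof (intro exI[of _ "(\<lambda>k. {of_int k<..<of_int k + 1}) ` {k. even k}"] conjI ballI)
    have "{of_int k<..<of_int k + 1 :: real} \<inter> {of_int l<..<of_int l + 1 :: real} = {}" if "k \<noteq> l" for k l :: int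
    proof -
      from that have "k + 1 \<le> l \<or> l + 1 \<le> k" by linarith
      then have "of_int k + 1 \<le> (of_int l :: real) \<or> of_int l + 1 \<le> (of_int k :: real)" by linarith
      then show ?thesis by auto
    qed
    then show "disjoint ((\<lambda>k. {of_int k<..<of_int k + 1 :: real}) ` {k. even k})"
      by (intro disjoint_imageI) auto
    fix A assume "A \<in> (\<lambda>k. {of_int k<..<of_int k + 1 :: real}) ` {k. even k}"
    then obtain k where k: "even k" "A = {of_int k<..<of_int k + 1}" by auto
    show "A \<noteq> {}" "is_interval A" "openin (top_of_set UNIV) A" using k by (auto simp: is_interval_oo)
    show "strict_mono_on A (\<lambda>\<mu>. fst (Gam \<mu>))"
      using k even_leg[of k] by (auto simp: Gam_def interpolate_on[of k] intro!: strict_mono_onI)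
  qed (auto simp: slow_def)
  show "disjoint_union_of_intervals
     (\<lambda>A. closedin (top_of_set UNIV) A \<and> nondegenerate A \<and> (\<lambda>\<mu>. fst (Gam \<mu>)) constant_on A \<and>
          strict_antimono_on A (\<lambda>\<mu>. snd (Gam \<mu>))) fast"
    unfolding disjoint_union_of_intervals_def
  proof (intro exI[of _ "(\<lambda>k. {of_int k..of_int k + 1}) ` {k. odd k}"] conjI ballI)
    have "{of_int k..of_int k + 1 :: real} \<inter> {of_int l..of_int l + 1 :: real} = {}" if "odd k" "odd l" "k \<noteq> l" for k l :: int
    proof -
      have "k \<noteq> l + 1" "l \<noteq> k + 1" using that by auto
      with that(3) have "k + 1 < l \<or> l + 1 < k" by linarith
      then have "of_int k + 1 < (of_int l :: real) \<or> of_int l + 1 < (of_int k :: real)" by linarith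
      then show ?thesis by auto
    qed
    then show "disjoint ((\<lambda>k. {of_int k..of_int k + 1 :: real}) ` {k. odd k})"
      by (intro disjoint_imageI) auto
    fix A assume "A \<in> (\<lambda>k. {of_int k..of_int k + 1 :: real}) ` {k. odd k}"
    then obtain k where k: "odd k" "A = {of_int k..of_int k + 1}" by auto
    show "A \<noteq> {}" "is_interval A" "closedin (top_of_set UNIV) A"
      using k by (auto simp: is_interval_cc)
    show "nondegenerate A" unfolding nondegenerate_def k
      by (intro bexI[of _ "of_int k"] bexI[of _ "of_int k + 1"]) auto
    show "(\<lambda>\<mu>. fst (Gam \<mu>)) constant_on A"
      unfolding constant_on_def using k odd_leg[of k] by (auto simp: Gam_def interpolate_on[of k])
    show "strict_antimono_on A (\<lambda>\<mu>. snd (Gam \<mu>))"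
      using k odd_leg[of k] c
      by (auto simp: Gam_def interpolate_on[of k] divide_strict_right_mono mult_strict_right_mono_neg intro!: monotone_onI)
  qed (auto simp: fast_def)
  show "disjoint_union_of_intervals
     (\<lambda>A. closedin (top_of_set UNIV) A \<and> nondegenerate A \<and> (\<lambda>\<mu>. fst (Gam \<mu>)) constant_on A \<and>
          strict_mono_on A (\<lambda>\<mu>. snd (Gam \<mu>))) {}"
    unfolding disjoint_union_of_intervals_def by (intro exI[of _ "{}"]) auto
qed auto

subsection \<open>The paths of the three arguments\<close>

text \<open>Parameters of the points of the curve, other than corners, at which a phase begins or ends,
  relative to a corner of the leg in question: \<open>r\<close> is the point of the first leg a time \<open>d\<close>
  after its start; \<open>q1\<close> and \<open>q2\<close> are the points of the fourth leg at depths \<open>T1 - d\<close> and \<open>T1\<close>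
  below its top, where \<open>\<mu>1\<close>, respectively \<open>\<mu>2\<close>, reaches the jump of size \<open>d\<close>; \<open>p1\<close> and \<open>p2\<close> are the
  points of the fourth leg at heights \<open>T1 / K1\<close> and \<open>T2 / K2\<close> above its bottom, where the slides
  of \<open>\<mu>1\<close> and \<open>\<mu>2\<close> begin.\<close>

definition r where "r = d / T1"
definition q1 where "q1 = (T1 - d) / (T - d)"
definition q2 where "q2 = T1 / (T - d)"
definition p1 where "p1 = - T1 / (K1 * (T - d))"
definition p2 where "p2 = - T2 / (K2 * (T - d))"

lemma positions: "0 < r" "r < 1" "0 < q1" "q1 < q2" "q2 < 1" "- 1 < p1" "p1 < 0" "- 1 < p2" "p2 < 0"
  using d_bounds T12 K level1 level2 mult_strict_right_mono[of d T d]
  by (auto simp: r_def q1_def q2_def p1_def p2_def field_simps)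

text \<open>The legs from \<open>-2\<close> to \<open>0\<close> are the last two of the preceding period, on which the delayed
  arguments start.\<close>

lemma leg_values:
  "-2 \<le> x \<Longrightarrow> x \<le> -1 \<Longrightarrow> interpolate tn x = (x + 1) * T2"
  "-2 \<le> x \<Longrightarrow> x \<le> -1 \<Longrightarrow> interpolate vn x = b + T - d + (x + 1) * T2"
  "-1 \<le> x \<Longrightarrow> x \<le> 0 \<Longrightarrow> interpolate tn x = 0"
  "-1 \<le> x \<Longrightarrow> x \<le> 0 \<Longrightarrow> interpolate vn x = b - x * (T - d)"
  "0 \<le> x \<Longrightarrow> x \<le> 1 \<Longrightarrow> interpolate tn x = x * T1"
  "0 \<le> x \<Longrightarrow> x \<le> 1 \<Longrightarrow> interpolate vn x = b + x * T1"
  "1 \<le> x \<Longrightarrow> x \<le> 2 \<Longrightarrow> interpolate tn x = T1"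
  "1 \<le> x \<Longrightarrow> x \<le> 2 \<Longrightarrow> interpolate vn x = b + T1 - (x - 1) * d"
  "2 \<le> x \<Longrightarrow> x \<le> 3 \<Longrightarrow> interpolate tn x = T1 + (x - 2) * T2"
  "2 \<le> x \<Longrightarrow> x \<le> 3 \<Longrightarrow> interpolate vn x = b + T1 - d + (x - 2) * T2"
  "3 \<le> x \<Longrightarrow> x \<le> 4 \<Longrightarrow> interpolate tn x = T"
  "3 \<le> x \<Longrightarrow> x \<le> 4 \<Longrightarrow> interpolate vn x = b + (4 - x) * (T - d)"
  using interpolate_on[of "-2" x tn] interpolate_on[of "-1" x tn] interpolate_on[of 0 x tn]
    interpolate_on[of 1 x tn] interpolate_on[of 2 x tn] interpolate_on[of 3 x tn]
    interpolate_on[of "-2" x vn] interpolate_on[of "-1" x vn] interpolate_on[of 0 x vn]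
    interpolate_on[of 1 x vn] interpolate_on[of 2 x vn] interpolate_on[of 3 x vn]
  by (simp_all add: algebra_simps)

text \<open>Positions of \<open>\<mu>0\<close>, and of \<open>\<mu>1\<close> and \<open>\<mu>2\<close> moved forward by \<open>n\<close> and \<open>n + m\<close> periods, at the
  starts of the ten phases:
  \<^enum> \<open>\<mu>0\<close> runs along the first leg, \<open>\<mu>1\<close> slides down from \<open>p1\<close> to the corner, \<open>F = 0\<close>;
  \<^enum> \<open>\<mu>0\<close> falls along the second leg;
  \<^enum> \<open>\<mu>0\<close> waits while \<open>\<mu>2\<close> descends to \<open>p2\<close>, which brings \<open>F\<close> back to zero;
  \<^enum> \<open>\<mu>0\<close> runs along the third leg, \<open>\<mu>2\<close> slides down from \<open>p2\<close> to the corner, \<open>F = 0\<close>;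
  \<^enum> \<open>\<mu>0\<close> falls along the fourth leg until \<open>\<mu>1\<close> meets the second leg;
  \<^enum> \<open>\<mu>0\<close> waits while \<open>\<mu>1\<close> descends that leg;
  \<^enum> \<open>\<mu>0\<close> falls further until \<open>\<mu>2\<close> meets the second leg;
  \<^enum> \<open>\<mu>0\<close> waits while \<open>\<mu>2\<close> descends that leg;
  \<^enum> \<open>\<mu>0\<close> falls to the bottom of the fourth leg;
  \<^enum> \<open>\<mu>0\<close> waits while \<open>\<mu>1\<close> descends to the start of its next slide, where \<open>F = 0\<close>.\<close>

definition "X0 = [0, 1, 2, 2, 3, 3 + q1, 3 + q1, 3 + q2, 3 + q2, 4]"
definition "X1 = [p1, 0, r, r, r, 1, 2, 2 + \<theta>, 2 + \<theta>, 3]"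
definition "X2 = [-1 - \<theta>, -1 - \<theta>, -1, p2, 0, 1 - r, 1 - r, 1, 2, 3 - \<theta>]"

lemma position_products: "r * T1 = d" "q1 * (T - d) = T1 - d" "q2 * (T - d) = T1"
  "p1 * (T - d) = - T1 / K1" "p2 * (T - d) = - T2 / K2" "\<theta> * T2 = d"
  using d_bounds T12 by (simp_all add: d r_def q1_def q2_def p1_def p2_def)

lemma tables:
  "map (interpolate tn) X0 = [0, T1, T1, T1, T, T, T, T, T, T]"
  "map (interpolate vn) X0 =
     [b, b + T1, b + T1 - d, b + T1 - d, b + T - d, b + T2, b + T2, b + T2 - d, b + T2 - d, b]"
  "map (interpolate tn) X1 = [0, 0, d, d, d, T1, T1, T1 + d, T1 + d, T]"
  "map (interpolate vn) X1 =
     [b + T1 / K1, b, b + d, b + d, b + d, b + T1, b + T1 - d, b + T1, b + T1, b + T - d]"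
  "map (interpolate tn) X2 = [- d, - d, 0, 0, 0, T1 - d, T1 - d, T1, T1, T - d]"
  "map (interpolate vn) X2 =
     [b + T - 2 * d, b + T - 2 * d, b + T - d, b + T2 / K2, b, b + T1 - d, b + T1 - d, b + T1,
      b + T1 - d, b + T - 2 * d]"
  using positions \<theta>(1,2) position_products T12
  by (simp_all add: X0_def X1_def X2_def leg_values left_diff_distrib distrib_right)

definition x0 where "x0 = periodic_nodes X0 4"
definition x1 where "x1 k = periodic_nodes X1 4 k + of_int (4 * - int n)"
definition x2 where "x2 k = periodic_nodes X2 4 k + of_int (4 * - int (n + m))"

text \<open>The leg in which \<open>\<mu>0\<close> stays during each phase. Even entries, that is rising legs, occur only
  at the indices 0 and 3.\<close>

definition "legs0 = [0, 1, 1, 2, 3, 3, 3, 3, 3, 3 :: int]"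

lemma x0_leg:
  assumes "l = legs0 ! nat (k mod 10) + 4 * (k div 10)"
  shows "x0 k \<in> {of_int l..of_int l + 1}" "x0 (k + 1) \<in> {of_int l..of_int l + 1}"
  using periodic_nodes_leg[where xs = X0 and P = 4 and ls = legs0 and l = l and k = k] positions assms by (simp_all add: x0_def X0_def legs0_def)

lemma x1_leg: "same_leg (x1 k) (x1 (k + 1))"
proof -
  define l where "l = [-1, 0, 0, 0, 0, 1, 2, 2, 2, 3] ! nat (k mod 10) + 4 * (k div 10)"
  have "same_leg (periodic_nodes X1 4 k) (periodic_nodes X1 4 (k + 1))"
    using periodic_nodes_leg[where xs = X1 and P = 4 and ls = "[-1, 0, 0, 0, 0, 1, 2, 2, 2, 3]" and l = l and k = k] positions \<theta>
    unfolding same_leg_def by (intro exI[of _ l]) (simp add: X1_def l_def)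
  then show ?thesis using same_leg_shift unfolding x1_def by blast
qed

lemma x2_leg: "same_leg (x2 k) (x2 (k + 1))"
proof -
  define l where "l = [-2, -2, -1, -1, 0, 0, 0, 1, 2, 2] ! nat (k mod 10) + 4 * (k div 10)"
  have "same_leg (periodic_nodes X2 4 k) (periodic_nodes X2 4 (k + 1))"
    using periodic_nodes_leg[where xs = X2 and P = 4 and ls = "[-2, -2, -1, -1, 0, 0, 0, 1, 2, 2]" and l = l and k = k] positions \<theta>
    unfolding same_leg_def by (intro exI[of _ l]) (simp add: X2_def l_def)
  then show ?thesis using same_leg_shift unfolding x2_def by blast
qed

lemma tn_at:
  assumes "xs \<noteq> []"
  shows "interpolate tn (periodic_nodes xs 4 k + of_int (4 * l)) =
    periodic_nodes (map (interpolate tn) xs) T k + T * of_int l"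
  using interpolate_at_periodic_nodes[OF assms, of "[0, T1, T1, T]" T k l]
  unfolding tn_def by simp

lemma vn_at:
  assumes "xs \<noteq> []"
  shows "interpolate vn (periodic_nodes xs 4 k + of_int (4 * l)) =
    periodic_nodes (map (interpolate vn) xs) 0 k"
  using interpolate_at_periodic_nodes[OF assms, of "[b, b + T1, b + T1 - d, b + T - d]" 0 k l]
  unfolding vn_def by simp

lemma node_values:
  "interpolate tn (x0 k) = periodic_nodes [0, T1, T1, T1, T, T, T, T, T, T] T k"
  "interpolate vn (x0 k) = periodic_nodes
     [b, b + T1, b + T1 - d, b + T1 - d, b + T - d, b + T2, b + T2, b + T2 - d, b + T2 - d, b] 0 k"
  "interpolate tn (x1 k) =
     periodic_nodes [0, 0, d, d, d, T1, T1, T1 + d, T1 + d, T] T k - real n * T"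
  "interpolate vn (x1 k) = periodic_nodes
     [b + T1 / K1, b, b + d, b + d, b + d, b + T1, b + T1 - d, b + T1, b + T1, b + T - d] 0 k"
  "interpolate tn (x2 k) =
     periodic_nodes [- d, - d, 0, 0, 0, T1 - d, T1 - d, T1, T1, T - d] T k - real (n + m) * T"
  "interpolate vn (x2 k) = periodic_nodes
     [b + T - 2 * d, b + T - 2 * d, b + T - d, b + T2 / K2, b, b + T1 - d, b + T1 - d, b + T1,
      b + T1 - d, b + T - 2 * d] 0 k"
proof -
  have ne: "X0 \<noteq> []" "X1 \<noteq> []" "X2 \<noteq> []" by (simp_all add: X0_def X1_def X2_def)
  show "interpolate tn (x0 k) = periodic_nodes [0, T1, T1, T1, T, T, T, T, T, T] T k"
    using tn_at[OF ne(1), of k 0] by (simp add: x0_def tables)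
  show "interpolate vn (x0 k) = periodic_nodes
     [b, b + T1, b + T1 - d, b + T1 - d, b + T - d, b + T2, b + T2, b + T2 - d, b + T2 - d, b] 0 k"
    using vn_at[OF ne(1), of k 0] by (simp add: x0_def tables)
  show "interpolate tn (x1 k) =
     periodic_nodes [0, 0, d, d, d, T1, T1, T1 + d, T1 + d, T] T k - real n * T"
    unfolding x1_def tn_at[OF ne(2)] tables by (simp add: mult.commute)
  show "interpolate vn (x1 k) = periodic_nodes
     [b + T1 / K1, b, b + d, b + d, b + d, b + T1, b + T1 - d, b + T1, b + T1, b + T - d] 0 k"
    unfolding x1_def vn_at[OF ne(2)] tables ..
  show "interpolate tn (x2 k) =
     periodic_nodes [- d, - d, 0, 0, 0, T1 - d, T1 - d, T1, T1, T - d] T k - real (n + m) * T"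
    unfolding x2_def tn_at[OF ne(3)] tables by (simp add: algebra_simps)
  show "interpolate vn (x2 k) = periodic_nodes
     [b + T - 2 * d, b + T - 2 * d, b + T - d, b + T2 / K2, b, b + T1 - d, b + T1 - d, b + T1,
      b + T1 - d, b + T - 2 * d] 0 k"
    unfolding x2_def vn_at[OF ne(3)] tables ..
qed

subsection \<open>The sign of F\<close>

lemma delay_nodes:
  "interpolate tn (x1 k) = interpolate tn (x0 k) - a1 - interpolate vn (x0 k)"
  "interpolate tn (x2 k) = interpolate tn (x0 k) - a2 - interpolate vn (x0 k)"
proof -
  have a1: "a1 = real n * T - b" using b by simp
  obtain j q where j: "j = 0 \<or> j = 1 \<or> j = 2 \<or> j = 3 \<or> j = 4 \<or> j = 5 \<or> j = 6 \<or> j = 7 \<or> j = 8 \<or> j = 9"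
    and node: "\<And>xs C. length xs = 10 \<Longrightarrow> periodic_nodes xs C k = xs ! j + C * of_int q"
    by (rule ten_phases[of k]) (rule that; assumption)
  show "interpolate tn (x1 k) = interpolate tn (x0 k) - a1 - interpolate vn (x0 k)"
    unfolding node_values a1 using j by (elim disjE) (simp_all add: node)
  show "interpolate tn (x2 k) = interpolate tn (x0 k) - a2 - interpolate vn (x0 k)"
    unfolding node_values a2 a1 using j by (elim disjE) (simp_all add: node algebra_simps)
qed

text \<open>The excess is \<open>- c F\<close> at the nodes.\<close>

definition excess where
  "excess k = interpolate vn (x0 k) + K1 * interpolate vn (x1 k) + K2 * interpolate vn (x2 k)"

lemma excess_zero: "excess k = 0" if "k mod 10 \<in> {0, 1, 3, 4}"
proof -
  obtain j q where "k mod 10 = int j"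
    and node: "\<And>xs C. length xs = 10 \<Longrightarrow> periodic_nodes xs C k = xs ! j + C * of_int q"
    by (rule ten_phases[of k]) (rule that; assumption)
  with that have "j = 0 \<or> j = 1 \<or> j = 3 \<or> j = 4" by auto
  then show ?thesis
    unfolding excess_def node_values using leg1_balance leg3_balance K
    by (elim disjE) (simp_all add: node algebra_simps)
qed

text \<open>The three positive products are the gains of \<open>- c F\<close>, at rate \<open>K1 + K2 - 1\<close>, over the times
  \<open>d\<close>, \<open>T1 - d\<close> and \<open>T2 - d\<close> of the second, fifth and ninth phase.\<close>

lemma excess_pos: "excess k > 0" if "k mod 10 \<notin> {0, 1, 3, 4}"
proof -
  obtain j q where kj: "k mod 10 = int j"
    and j: "j = 0 \<or> j = 1 \<or> j = 2 \<or> j = 3 \<or> j = 4 \<or> j = 5 \<or> j = 6 \<or> j = 7 \<or> j = 8 \<or> j = 9"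
    and node: "\<And>xs C. length xs = 10 \<Longrightarrow> periodic_nodes xs C k = xs ! j + C * of_int q"
    by (rule ten_phases[of k]) (rule that; assumption)
  have "j = 2 \<or> j = 5 \<or> j = 6 \<or> j = 7 \<or> j = 8 \<or> j = 9" using that j unfolding kj by force
  moreover have "d * (K1 + K2 - 1) > 0" "(T1 - d) * (K1 + K2 - 1) > 0" "(T2 - d) * (K1 + K2 - 1) > 0"
    using d_bounds K by simp_all
  ultimately show ?thesis
    unfolding excess_def node_values using leg1_balance leg3_balance drop1 drop2
    by (elim disjE) (simp_all add: node algebra_simps)
qed

definition \<mu>0 where "\<mu>0 = interpolate x0"
definition \<mu>1 where "\<mu>1 = interpolate x1"
definition \<mu>2 where "\<mu>2 = interpolate x2"

lemma same_leg_x0: "same_leg (x0 k) (x0 (k + 1))"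
  unfolding same_leg_def using x0_leg[OF refl] by blast

lemma profile_along:
  "interpolate y (\<mu>0 \<eta>) = interpolate (\<lambda>k. interpolate y (x0 k)) \<eta>"
  "interpolate y (\<mu>1 \<eta>) = interpolate (\<lambda>k. interpolate y (x1 k)) \<eta>"
  "interpolate y (\<mu>2 \<eta>) = interpolate (\<lambda>k. interpolate y (x2 k)) \<eta>"
  unfolding \<mu>0_def \<mu>1_def \<mu>2_def
  by (intro interpolate_compose same_leg_x0 x1_leg x2_leg)+

lemma delays:
  "interpolate tn (\<mu>1 \<eta>) = interpolate tn (\<mu>0 \<eta>) - a1 - interpolate vn (\<mu>0 \<eta>)"
  "interpolate tn (\<mu>2 \<eta>) = interpolate tn (\<mu>0 \<eta>) - a2 - interpolate vn (\<mu>0 \<eta>)"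
  unfolding profile_along delay_nodes interpolate_linear by simp_all

lemma excess_along:
  "interpolate vn (\<mu>0 \<eta>) + K1 * interpolate vn (\<mu>1 \<eta>) + K2 * interpolate vn (\<mu>2 \<eta>) =
     interpolate excess \<eta>"
  unfolding profile_along excess_def interpolate_linear ..

lemma \<mu>0_slow:
  assumes "k mod 10 \<in> {0, 3}" "of_int k < \<eta>" "\<eta> < of_int k + 1"
  shows "\<mu>0 \<eta> \<in> slow"
proof -
  define l where "l = legs0 ! nat (k mod 10) + 4 * (k div 10)"
  have l: "even l" "x0 k = of_int l" "x0 (k + 1) = of_int l + 1"
  proof -
    obtain j q where kj: "k mod 10 = int j"
      and node: "\<And>xs C. length xs = 10 \<Longrightarrow> periodic_nodes xs C k = xs ! j + C * of_int q"
      and next_node: "\<And>xs C. length xs = 10 \<Longrightarrow>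
        periodic_nodes xs C (k + 1) = (tl xs @ [hd xs + C]) ! j + C * of_int q"
      and q: "k div 10 = q"
      by (rule ten_phases[of k]) (rule that; assumption)
    have "j = 0 \<or> j = 3" using assms(1) kj by auto
    then show "even l" "x0 k = of_int l" "x0 (k + 1) = of_int l + 1"
      unfolding l_def kj q x0_def by (auto simp: node next_node legs0_def X0_def)
  qed
  have "\<mu>0 \<eta> = of_int l + (\<eta> - of_int k)"
    unfolding \<mu>0_def using interpolate_on[of k \<eta> x0] assms l by simp
  then have "\<mu>0 \<eta> \<in> {of_int l<..<of_int l + 1}" using assms by simp
  with l(1) show ?thesis unfolding slow_def by blast
qed

lemma \<mu>0_fast:
  assumes "k mod 10 \<notin> {0, 3}" "of_int k \<le> \<eta>" "\<eta> \<le> of_int k + 1"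
  shows "\<mu>0 \<eta> \<in> fast"
proof -
  define l where "l = legs0 ! nat (k mod 10) + 4 * (k div 10)"
  have l: "odd l"
  proof -
    obtain j q where kj: "k mod 10 = int j"
      and j: "j = 0 \<or> j = 1 \<or> j = 2 \<or> j = 3 \<or> j = 4 \<or> j = 5 \<or> j = 6 \<or> j = 7 \<or> j = 8 \<or> j = 9"
      by (rule ten_phases[of k]) (rule that; assumption)
    show ?thesis using assms(1) j unfolding l_def kj by (elim disjE) (simp_all add: legs0_def)
  qed
  have "\<mu>0 \<eta> \<in> {of_int l..of_int l + 1}"
    unfolding \<mu>0_def
    using interpolate_between[of k \<eta> "of_int l" x0 "of_int l + 1"] x0_leg[OF l_def] assms by auto
  with l show ?thesis unfolding fast_def by blast
qed

text \<open>The zero set of \<open>F\<close> is closed, so \<open>F = 0\<close> passes from the parameters with \<open>\<mu>0\<close> in \<open>I\<^sup>*\<close> to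
  their closure \<open>J\<^sup>*\<close>.\<close>

lemma excess_on_slow:
  assumes "\<eta> \<in> closure {\<eta>. \<mu>0 \<eta> \<in> slow}"
  shows "interpolate excess \<eta> = 0"
proof -
  have "interpolate excess \<eta> = 0" if "\<mu>0 \<eta> \<in> slow" for \<eta>
  proof -
    have k: "of_int \<lfloor>\<eta>\<rfloor> \<le> \<eta>" "\<eta> \<le> of_int \<lfloor>\<eta>\<rfloor> + 1" by simp_all
    then have "\<lfloor>\<eta>\<rfloor> mod 10 \<in> {0, 3}" using that \<mu>0_fast slow_fast(1) by blast
    moreover from this have "(\<lfloor>\<eta>\<rfloor> + 1) mod 10 \<in> {1, 4}" unfolding insert_iff empty_iff by presburger
    ultimately have "excess \<lfloor>\<eta>\<rfloor> = 0" "excess (\<lfloor>\<eta>\<rfloor> + 1) = 0" by (auto intro: excess_zero)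
    then show ?thesis by (simp add: interpolate_def)
  qed
  moreover have "closed {\<eta>. interpolate excess \<eta> = 0}"
    by (intro closed_Collect_eq continuous_on_interpolate continuous_on_const)
  ultimately have "closure {\<eta>. \<mu>0 \<eta> \<in> slow} \<subseteq> {\<eta>. interpolate excess \<eta> = 0}"
    by (intro closure_minimal) auto
  with assms show ?thesis by auto
qed

text \<open>In each period \<open>F\<close> vanishes at the four endpoints of the phases in which \<open>\<mu>0\<close> runs along a rising leg, and
  \<open>\<mu>0\<close> is at a corner there, hence in \<open>I\<^sup>-\<close>. These endpoints are limits of parameters with \<open>\<mu>0\<close>
  in \<open>I\<^sup>*\<close> and so do not lie in the interior that defines \<open>J\<^sup>-\<close>. Everywhere else in \<open>J\<^sup>-\<close> at
  least one neighbouring node has positive excess.\<close>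

lemma excess_on_fast:
  assumes \<eta>: "\<eta> \<in> interior {\<eta>. \<mu>0 \<eta> \<in> fast}"
  shows "interpolate excess \<eta> > 0"
proof -
  define k where "k = \<lfloor>\<eta>\<rfloor>"
  have k: "of_int k \<le> \<eta>" "\<eta> < of_int k + 1" by (simp_all add: k_def)
  have off: "l mod 10 \<notin> {0, 3}" if "\<eta> \<in> {of_int l..of_int l + 1}" for l
  proof
    assume l: "l mod 10 \<in> {0, 3}"
    have "{\<eta>. \<mu>0 \<eta> \<in> fast} \<inter> {of_int l<..<of_int l + 1} = {}"
      using \<mu>0_slow[OF l] slow_fast(1) by (auto simp: disjoint_iff)
    then have "interior {\<eta>. \<mu>0 \<eta> \<in> fast} \<inter> {of_int l<..<of_int l + 1} = {}"
      using interior_subset by blast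
    then have "interior {\<eta>. \<mu>0 \<eta> \<in> fast} \<inter> closure {of_int l<..<of_int l + 1} = {}"
      unfolding open_Int_closure_eq_empty[OF open_interior] .
    with that \<eta> show False by auto
  qed
  have kmod: "k mod 10 \<notin> {0, 3}" using off k by simp
  show ?thesis
  proof (cases "\<eta> = of_int k")
    case True
    then have "(k - 1) mod 10 \<notin> {0, 3}" using off[of "k - 1"] by simp
    then have "k mod 10 \<notin> {1, 4}" by simp presburger
    with kmod show ?thesis using True excess_pos[of k] by simp
  next
    case False
    have nonneg: "excess l \<ge> 0" for l
      using excess_zero[of l] excess_pos[of l] by (cases "l mod 10 \<in> {0, 1, 3, 4}") auto
    have pos: "excess k > 0 \<or> excess (k + 1) > 0"
    proof (cases "k mod 10 \<in> {1, 4}")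
      case True
      then have "(k + 1) mod 10 \<notin> {0, 1, 3, 4}" by simp presburger
      then show ?thesis using excess_pos by blast
    next
      case False
      then show ?thesis using kmod excess_pos[of k] by auto
    qed
    define s where "s = \<eta> - of_int k"
    have s: "0 < s" "s < 1" using k False by (auto simp: s_def)
    have "interpolate excess \<eta> = (1 - s) * excess k + s * excess (k + 1)"
      using interpolate_on[of k \<eta> excess] k by (simp add: s_def algebra_simps)
    also have "\<dots> > 0"
      using pos nonneg[of k] nonneg[of "k + 1"] s
      by (metis add_nonneg_pos add_pos_nonneg diff_gt_0_iff_gt less_imp_le mult_nonneg_nonneg mult_pos_pos)
    finally show ?thesis .
  qed
qed

lemma x0_mono: "x0 k \<le> x0 (k + 1)"
proof -
  obtain j q where j: "j = 0 \<or> j = 1 \<or> j = 2 \<or> j = 3 \<or> j = 4 \<or> j = 5 \<or> j = 6 \<or> j = 7 \<or> j = 8 \<or> j = 9"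
    and node: "\<And>xs C. length xs = 10 \<Longrightarrow> periodic_nodes xs C k = xs ! j + C * of_int q"
    and next_node: "\<And>xs C. length xs = 10 \<Longrightarrow>
      periodic_nodes xs C (k + 1) = (tl xs @ [hd xs + C]) ! j + C * of_int q"
    by (rule ten_phases[of k]) (rule that; assumption)
  then show ?thesis
    unfolding x0_def using positions by (elim disjE) (simp_all add: node next_node X0_def)
qed

lemma singular_solution_Gam: "singular_solution K1 K2 a1 a2 c UNIV Gam UNIV \<mu>0 \<mu>1 \<mu>2"
  unfolding singular_solution_def Let_def
proof (intro exI conjI ballI)
  show "admissible_profile UNIV Gam {} fast slow" by (rule admissible_Gam)
  show "mono \<mu>0" unfolding \<mu>0_def by (intro mono_interpolate x0_mono)
  show "continuous_on UNIV \<mu>" if "\<mu> \<in> {\<mu>0, \<mu>1, \<mu>2}" for \<mu>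
    using that continuous_on_interpolate by (auto simp: \<mu>0_def \<mu>1_def \<mu>2_def)
  fix \<eta> :: real
  show "fst (Gam (\<mu>1 \<eta>)) = fst (Gam (\<mu>0 \<eta>)) - a1 - c * snd (Gam (\<mu>0 \<eta>))"
    "fst (Gam (\<mu>2 \<eta>)) = fst (Gam (\<mu>0 \<eta>)) - a2 - c * snd (Gam (\<mu>0 \<eta>))"
    using c delays by (simp_all add: Gam_def)
  have F: "- snd (Gam (\<mu>0 \<eta>)) - K1 * snd (Gam (\<mu>1 \<eta>)) - K2 * snd (Gam (\<mu>2 \<eta>)) =
      - interpolate excess \<eta> / c"
    unfolding excess_along[symmetric] by (simp add: Gam_def add_divide_distrib diff_divide_distrib)
  show "- snd (Gam (\<mu>0 \<eta>)) - K1 * snd (Gam (\<mu>1 \<eta>)) - K2 * snd (Gam (\<mu>2 \<eta>)) = 0"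
    if "\<eta> \<in> UNIV \<inter> closure {\<eta> \<in> UNIV. \<mu>0 \<eta> \<in> slow}"
    using that excess_on_slow unfolding F by simp
  show "- snd (Gam (\<mu>0 \<eta>)) - K1 * snd (Gam (\<mu>1 \<eta>)) - K2 * snd (Gam (\<mu>2 \<eta>)) < 0"
    if "\<eta> \<in> interior {\<eta> \<in> UNIV. \<mu>0 \<eta> \<in> fast}"
    using that excess_on_fast c unfolding F by simp
qed auto

subsection \<open>Periodicity\<close>

lemma Gam_shift: "fst (Gam (x + 4)) = fst (Gam x) + T" "snd (Gam (x + 4)) = snd (Gam x)"
  using interpolate_shift[of tn 4 T x] interpolate_shift[of vn 4 0 x] tn_shift[of _ 1] vn_shift[of _ 1]
  by (simp_all add: Gam_def)

lemma \<mu>_shift: "\<mu>0 (\<eta> + 10) = \<mu>0 \<eta> + 4" "\<mu>1 (\<eta> + 10) = \<mu>1 \<eta> + 4" "\<mu>2 (\<eta> + 10) = \<mu>2 \<eta> + 4"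
proof -
  have "x0 (k + 10) = x0 k + 4" "x1 (k + 10) = x1 k + 4" "x2 (k + 10) = x2 k + 4" for k
    using periodic_nodes_shift[of X0 4 k 1] periodic_nodes_shift[of X1 4 k 1] periodic_nodes_shift[of X2 4 k 1]
    by (simp_all add: x0_def x1_def x2_def X0_def X1_def X2_def)
  then show "\<mu>0 (\<eta> + 10) = \<mu>0 \<eta> + 4" "\<mu>1 (\<eta> + 10) = \<mu>1 \<eta> + 4" "\<mu>2 (\<eta> + 10) = \<mu>2 \<eta> + 4"
    unfolding \<mu>0_def \<mu>1_def \<mu>2_def
    using interpolate_shift[of x0 10 4 \<eta>] interpolate_shift[of x1 10 4 \<eta>] interpolate_shift[of x2 10 4 \<eta>]
    by simp_all
qed

text \<open>At every corner \<open>v \<ge> b\<close>, with equality only at the bottom of the fourth leg. A convex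
  combination of two consecutive corner values is therefore \<open>b\<close> only at such a corner.\<close>

lemma minimum_of_u:
  assumes "interpolate vn x = b"
  obtains i :: int where "interpolate tn x = of_int i * T"
proof -
  define k s where "k = \<lfloor>x\<rfloor>" and "s = frac x"
  have s: "0 \<le> s" "s < 1" by (simp_all add: s_def frac_lt_1)
  have v: "(1 - s) * (vn k - b) + s * (vn (k + 1) - b) = 0"
    using assms by (simp add: interpolate_def k_def s_def algebra_simps)
  have ge: "vn j \<ge> b" for j
    using d_bounds T12 by (cases j rule: int_mod_4_cases) auto
  have "(1 - s) * (vn k - b) = 0" "s * (vn (k + 1) - b) = 0"
    using v s mult_nonneg_nonneg[of "1 - s" "vn k - b"] mult_nonneg_nonneg[of s "vn (k + 1) - b"] ge[of k] ge[of "k + 1"]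
    by linarith+
  then have vk: "vn k = b" and sk: "s = 0 \<or> vn (k + 1) = b" using s by auto
  obtain i where i: "k = 4 * i"
    using vk d_bounds T12 by (cases k rule: int_mod_4_cases) auto
  have "s = 0" using sk i T12 by auto
  then have "interpolate tn x = of_int i * T"
    using i by (simp add: interpolate_def flip: k_def s_def)
  then show ?thesis by (rule that)
qed

lemma periodic_singular_solution_Gam:
  "periodic_singular_solution K1 K2 a1 a2 c UNIV Gam \<mu>0 \<mu>1 \<mu>2 T"
  unfolding periodic_singular_solution_def
proof (intro conjI allI impI)
  show "singular_solution K1 K2 a1 a2 c UNIV Gam UNIV \<mu>0 \<mu>1 \<mu>2" by (rule singular_solution_Gam)
  show "shift_period Gam \<mu>0 \<mu>1 \<mu>2 T"
    unfolding shift_period_def using T12 by (auto simp: \<mu>_shift Gam_shift intro!: exI[of _ 10])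
  fix T' assume T': "shift_period Gam \<mu>0 \<mu>1 \<mu>2 T'"
  then obtain \<eta>T where \<eta>T: "fst (Gam (\<mu>0 (0 + \<eta>T))) = fst (Gam (\<mu>0 0)) + T'"
      "snd (Gam (\<mu>0 (0 + \<eta>T))) = snd (Gam (\<mu>0 0))" and pos: "T' > 0"
    unfolding shift_period_def by blast
  have "\<mu>0 0 = 0" using interpolate_of_int[of x0 0] by (simp add: \<mu>0_def x0_def periodic_nodes_def X0_def)
  with \<eta>T c have "interpolate tn (\<mu>0 \<eta>T) = T'" "interpolate vn (\<mu>0 \<eta>T) = b"
    using interpolate_of_int[of tn 0] interpolate_of_int[of vn 0] by (simp_all add: Gam_def)
  then obtain i :: int where i: "T' = of_int i * T" by (metis minimum_of_u)
  with pos T12 have "i > 0" by (simp add: zero_less_mult_iff)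
  then have "1 \<le> real_of_int i" by simp
  with i T12 show "T \<le> T'" using mult_right_mono[of 1 "real_of_int i" T] by simp
qed

end

section \<open>The type II bimodal solution\<close>

theorem theorem2p4:
  fixes K1 K2 a1 a2 c A T T1 T2 \<theta> :: real and m n :: nat
  assumes "K1 > 0" and "K1 + K2 > 1" and "1 > K2" and "K2 > 0"
    and "a2 > a1" and "a1 > 0" and "c > 0"
    and "A = a2 / a1"
    and "1 - real m * (K1 - 1) + real n * (1 + K1 + K2) \<noteq> 0"
    and "T = (a1 * (1 + K1 + K2) + (a2 - a1) * (1 - K1)) /
             (1 - real m * (K1 - 1) + real n * (1 + K1 + K2))"
    and "T2 = a1 * H_nm n m A K2 K1 /
              (1 - real m * (K1 - 1) + real n * (1 + K1 + K2))"
    and "T1 = T - T2"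
    and "\<theta> = (a2 - a1 - real m * T) / T2"
    and "T2 > 0" and "\<theta> \<in> {0<..<1}"
    and "\<theta> < T1 / T2 + 1 - 1 / K2"
    and "K1 \<ge> 1 \<Longrightarrow> \<theta> < (1 - K1 / (2 * K1 + K2 - 1)) * (T1 / T2)"
    and "K1 < 1 \<Longrightarrow>
           \<theta> < min (1 - (1 - K1) / K1 * (T1 / T2)) ((1 - 1 / (K1 + K2)) * (T1 / T2))"
  shows "T > 0 \<and>
    (\<exists>\<Gamma> \<mu>0 \<mu>1 \<mu>2.
       type_II_bimodal_profile a1 c n T T1 T2 \<theta> \<Gamma> \<and>
       periodic_singular_solution K1 K2 a1 a2 c UNIV \<Gamma> \<mu>0 \<mu>1 \<mu>2 T)"
proof -
  define D d b where "D = 1 - real m * (K1 - 1) + real n * (1 + K1 + K2)"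
    and "d = \<theta> * T2" and "b = - a1 + real n * T"
  note K = assms(1-4) and T12 = assms(12) and T2 = assms(14) and \<theta> = assms(15)
  have D: "D \<noteq> 0" using assms(9) by (simp add: D_def)
  have d: "d = a2 - a1 - real m * T" using assms(13) T2 by (simp add: d_def)
  have TD: "T * D = a1 * (1 + K1 + K2) + (a2 - a1) * (1 - K1)"
    using assms(10) D by (simp add: D_def)
  \<comment> \<open>The formula for \<open>T\<close> is the balance at the end of the third leg, solved for \<open>T\<close>.\<close>
  have leg3: "b * (1 + K1 + K2) + T - d + K1 * d = 0"
    using TD by (simp add: D_def b_def d algebra_simps)
  \<comment> \<open>The difference of the two balance equations; multiplied by \<open>D\<close> it gives \<open>H_nm\<close>.\<close>
  have T2_eq: "T2 = K2 * T - (2 * K2 + K1 - 1) * d"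
  proof -
    have "a1 * H_nm n m A K2 K1 =
      K2 * (T * D) - (2 * K2 + K1 - 1) * ((a2 - a1) * D - real m * (T * D))"
    proof -
      have "a1 * (A - 1) = a2 - a1" using assms(6,8) by (simp add: field_simps)
      moreover have "a1 * H_nm n m A K2 K1 =
        (real m * a1 - real n * (a1 * (A - 1))) * (K1 + K2 + 1) * (K1 + 2 * K2 - 1)
        - K1 * (a1 * (A - 1) * (1 + K2) - a1 * K2) + a1 * K2 * (1 + K2) + a1 * (A - 1) * (1 - K2)"
        by (simp add: H_nm_def algebra_simps)
      ultimately show ?thesis unfolding TD by (simp add: D_def algebra_simps)
    qed
    moreover have "T2 * D = a1 * H_nm n m A K2 K1" using assms(11) D by (simp add: D_def)
    ultimately have "T2 * D = (K2 * T - (2 * K2 + K1 - 1) * d) * D" by (simp add: d algebra_simps)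
    then show ?thesis using D by simp
  qed
  have T1: "0 < T1"
  proof -
    have "0 < (1 - K1 / (2 * K1 + K2 - 1)) * (T1 / T2)" "0 < 1 - K1 / (2 * K1 + K2 - 1)" if "K1 \<ge> 1"
      using assms(17)[OF that] \<theta> that K by (auto simp: field_simps)
    moreover have "0 < (1 - 1 / (K1 + K2)) * (T1 / T2)" "0 < 1 - 1 / (K1 + K2)" if "K1 < 1"
      using assms(18)[OF that] \<theta> that K by (auto simp: field_simps)
    ultimately have "0 < T1 / T2" by (metis not_le zero_less_mult_pos)
    then show ?thesis using T2 by (simp add: zero_less_divide_iff)
  qed
  have gap: "d * P < T1 * (P - q)" if "P > 0" "\<theta> < (1 - q / P) * (T1 / T2)" for P q
  proof -
    have "(1 - q / P) * (T1 / T2) = T1 * (P - q) / (P * T2)" using that(1) T2 by (simp add: field_simps)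
    with that(2) have "\<theta> < T1 * (P - q) / (P * T2)" by (simp only:)
    with that(1) T2 show ?thesis by (simp add: pos_less_divide_eq d_def mult_ac)
  qed
  \<comment> \<open>The two conclusions differ by \<open>d * (K1 - 1)\<close>, so the case distinction on \<open>K1\<close> selects the
      stronger one.\<close>
  have drops: "d * (2 * K1 + K2 - 1) < T1 * (K1 + K2 - 1) \<and> d * (K1 + K2) < T1 * (K1 + K2 - 1)"
  proof (cases "K1 \<ge> 1")
    case True
    have "d * (2 * K1 + K2 - 1) < T1 * (K1 + K2 - 1)"
      using gap[OF _ assms(17)[OF True]] K True by (simp add: algebra_simps)
    moreover have "d * (K1 + K2) \<le> d * (2 * K1 + K2 - 1)"
      using True \<theta> T2 by (intro mult_left_mono) (auto simp: d_def)
    ultimately show ?thesis by linarith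
  next
    case False
    then have "\<theta> < (1 - 1 / (K1 + K2)) * (T1 / T2)" using assms(18) by simp
    then have "d * (K1 + K2) < T1 * (K1 + K2 - 1)" using K by (intro gap) auto
    moreover have "d * (2 * K1 + K2 - 1) \<le> d * (K1 + K2)"
      using False \<theta> T2 by (intro mult_left_mono) (auto simp: d_def)
    ultimately show ?thesis by linarith
  qed
  have level1: "T1 < K1 * (T - d)"
  proof (cases "K1 \<ge> 1")
    case True
    have "T1 < T - d" using T12 T2 \<theta> by (simp add: d_def)
    also have "\<dots> \<le> K1 * (T - d)" using True calculation T1 by (simp add: mult_le_cancel_right1)
    finally show ?thesis .
  next
    case False
    then have "\<theta> < 1 - (1 - K1) / K1 * (T1 / T2)" using assms(18) by simp
    then show ?thesis using K T2 T12 by (simp add: d_def field_simps)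
  qed
  have level2: "T2 < K2 * (T - d)"
    using assms(16) K T2 T12 by (simp add: d_def field_simps)
  have T: "T1 + T2 = T" using T12 by simp
  interpret type_II_bimodal K1 K2 a1 a2 c b T1 T2 \<theta> d m n
  proof unfold_locales
    show "b * (1 + K1 + K2) + T1 + K2 * (T1 + T2 - 2 * d) = 0"
      using leg3 T2_eq unfolding T T12 by (simp add: algebra_simps)
    show "b * (1 + K1 + K2) + T1 + T2 - d + K1 * d = 0" using leg3 T by linarith
    show "\<theta> * T2 = d" by (simp add: d_def)
    show "- a1 + real n * (T1 + T2) = b" by (simp add: T b_def)
    show "a2 = a1 + real m * (T1 + T2) + d" by (simp add: T d)
    show "T1 < K1 * (T1 + T2 - d)" "T2 < K2 * (T1 + T2 - d)" using level1 level2 by (simp_all add: T)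
  qed (use K T1 T2 \<theta> assms(7) drops in simp_all)
  have "T > 0" using T1 T2 T by linarith
  then show ?thesis
    using Gam_profile periodic_singular_solution_Gam unfolding T by blast
qed

end
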